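(* Let $k,d,\ell$ be integers with $1\le d\le k-1$ and $0\le \ell\le k-1$. If $d\ge \max\{k-\ell,\ \lfloor k/2\rfloor+1\}$, then $g(k,d,\ell)=0$.
   Context: A $k$-graph $H$ is a $k$-uniform hypergraph: a finite vertex set $V(H)$ with edge set $E(H)\subseteq\binom{V(H)}{k}$. For $1\le d\le k-1$, $\deg_H(S)$ is the number of edges containing a $d$-set $S\subseteq V(H)$, and $\delta_d(H)=\min\deg_H(S)$ over all $d$-subsets $S$ of $V(H)$. Construction: let $0\le \ell\le k-1$, $j\in\{0,1,\dots,\ell+1\}$, $n\equiv \ell \pmod k$, and let $x\in[0,1]$ be a real number such that $xn$ is an integer with $xn\equiv \lfloor n/k\rfloor j+\ell+1 \pmod{\ell+2}$. Let $V$ be an $n$-set with a partition $V=V_1\cup V_2$, $|V_1|=xn$. $H_\ell^j(x)$ is the $k$-graph on $V$ whose edges are all $k$-sets $e$ with $|e\cap V_1|\equiv j \pmod{\ell+2}$. Define $$g(k,d,\ell):=\lim_{n\to\infty}\left(\max_{0\le j\le \ell+1}\max_{x}\ \delta_d(H_\ell^j(x))\Big/\binom{n-d}{k-d}\right),$$ where $n$ runs over integers $n\equiv \ell\pmod k$ and $x$ over the admissible values in $[0,1]$. *)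

theory Defs
  imports Complex_Main "HOL-Number_Theory.Cong"
begin

text \<open>A hypergraph is a pair of a vertex set and an edge set.\<close>

type_synonym 'a hypergraph = "'a set \<times> 'a set set"

abbreviation verts :: "'a hypergraph \<Rightarrow> 'a set" where "verts \<equiv> fst"
abbreviation edges :: "'a hypergraph \<Rightarrow> 'a set set" where "edges \<equiv> snd"

definition kgraph :: "nat \<Rightarrow> 'a hypergraph \<Rightarrow> bool" where
  "kgraph k H \<longleftrightarrow> finite (verts H) \<and> edges H \<subseteq> {e. e \<subseteq> verts H \<and> card e = k}"

definition deg :: "'a hypergraph \<Rightarrow> 'a set \<Rightarrow> nat" where
  "deg H S = card {e \<in> edges H. S \<subseteq> e}"

text \<open>The minimum is unspecified if \<open>H\<close> has fewer than \<open>d\<close> vertices.\<close>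

definition min_deg :: "nat \<Rightarrow> 'a hypergraph \<Rightarrow> nat" where
  "min_deg d H = Min (deg H ` {S. S \<subseteq> verts H \<and> card S = d})"

definition modular_kgraph :: "nat \<Rightarrow> nat \<Rightarrow> nat \<Rightarrow> 'a set \<Rightarrow> 'a set \<Rightarrow> 'a hypergraph" where
  "modular_kgraph k l j V\<^sub>1 V\<^sub>2 =
     (V\<^sub>1 \<union> V\<^sub>2, {e. e \<subseteq> V\<^sub>1 \<union> V\<^sub>2 \<and> card e = k \<and> [card (e \<inter> V\<^sub>1) = j] (mod (l + 2))})"

lemma kgraph_modular_kgraph:
  "finite V\<^sub>1 \<Longrightarrow> finite V\<^sub>2 \<Longrightarrow> kgraph k (modular_kgraph k l j V\<^sub>1 V\<^sub>2)"
  by (auto simp: kgraph_def modular_kgraph_def)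

text \<open>The values of \<open>x\<close> allowed for given \<open>n\<close> and \<open>j\<close>; since \<open>x \<ge> 0\<close>, integrality of
  \<open>x * n\<close> means that it is a natural number \<open>m\<close>.\<close>

definition admissible :: "nat \<Rightarrow> nat \<Rightarrow> nat \<Rightarrow> nat \<Rightarrow> real set" where
  "admissible k l j n =
     {x. 0 \<le> x \<and> x \<le> 1 \<and>
         (\<exists>m::nat. x * real n = real m \<and> [m = (n div k) * j + l + 1] (mod (l + 2)))}"

text \<open>\<open>H\<^sub>\<ell>\<^sup>j(x)\<close> on \<open>n\<close> vertices is determined up to isomorphism; we use the vertex set
  \<open>{..<n}\<close> and let \<open>V\<^sub>1\<close> consist of the first \<open>x * n\<close> vertices.\<close>

definition Hgraph :: "nat \<Rightarrow> nat \<Rightarrow> nat \<Rightarrow> nat \<Rightarrow> real \<Rightarrow> nat hypergraph" where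
  "Hgraph k l j n x =
     (let m = nat \<lfloor>x * real n\<rfloor> in modular_kgraph k l j {..<m} {m..<n})"

text \<open>For \<open>n > l\<close> every set \<open>admissible k l j n\<close> is finite and nonempty, and for \<open>n \<ge> d\<close> so is
  the set of \<open>d\<close>-subsets; the finitely many other \<open>n\<close>, where \<open>Max\<close> or \<open>Min\<close> may be
  unspecified, do not affect the limit.\<close>

definition max_min_deg_ratio :: "nat \<Rightarrow> nat \<Rightarrow> nat \<Rightarrow> nat \<Rightarrow> real" where
  "max_min_deg_ratio k d l n =
     real (MAX j\<in>{0..l + 1}. MAX x\<in>admissible k l j n. min_deg d (Hgraph k l j n x))
       / real ((n - d) choose (k - d))"

text \<open>\<open>n \<longrightarrow> \<infinity>\<close> along the residue class of \<open>l\<close> modulo \<open>k\<close>.\<close>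

definition at_top_cong :: "nat \<Rightarrow> nat \<Rightarrow> nat filter" where
  "at_top_cong k l = inf at_top (principal {n. [n = l] (mod k)})"

text \<open>\<open>Lim\<close> is a definite description, so statements about \<open>g\<close> are meaningful only
  together with convergence.\<close>

definition g :: "nat \<Rightarrow> nat \<Rightarrow> nat \<Rightarrow> real" where
  "g k d l = Lim (at_top_cong k l) (max_min_deg_ratio k d l)"

end

theory Submission
  imports Defs
begin

text \<open>Put \<open>s = |S \<inter> V\<^sub>1|\<close> for a \<open>d\<close>-set \<open>S\<close>. An edge containing \<open>S\<close> meets \<open>V\<^sub>1\<close> in \<open>s + t\<close> vertices
  with \<open>0 \<le> t \<le> k - d\<close>. If both parts have at least \<open>d\<close> vertices, every \<open>s \<le> d\<close> occurs, and the
  hypothesis on \<open>d\<close> leaves room to choose \<open>s\<close> such that none of the sums \<open>s + t\<close> is congruent to \<open>j\<close>;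
  then \<open>S\<close> has degree \<open>0\<close>. If a part has fewer than \<open>d\<close> vertices, then the congruence defining the
  admissible \<open>x\<close> guarantees (by excluding a complete graph when that part is empty) a set \<open>S\<close> all of
  whose edges use a further vertex of the small part. There are at most
  \<open>d * ((n - d - 1) choose (k - d - 1))\<close> such edges, so the ratio is at most
  \<open>d * (k - d) / (n - d)\<close>.\<close>

section \<open>Counting edges through a fixed set\<close>

lemma card_subsets_containing:
  assumes "finite A" "w \<in> A" "r > 0"
  shows "card {T. T \<subseteq> A \<and> card T = r \<and> w \<in> T} = (card A - 1) choose (r - 1)"
proof -
  have "bij_betw (insert w) {T. T \<subseteq> A - {w} \<and> card T = r - 1} {T. T \<subseteq> A \<and> card T = r \<and> w \<in> T}"
  proof (rule bij_betw_byWitness[where f' = "\<lambda>T. T - {w}"])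
    show "insert w ` {T. T \<subseteq> A - {w} \<and> card T = r - 1} \<subseteq> {T. T \<subseteq> A \<and> card T = r \<and> w \<in> T}"
    proof safe
      fix T assume "T \<subseteq> A - {w}" "card T = r - 1"
      moreover from this have "finite T" "w \<notin> T"
        using assms finite_subset by auto
      ultimately show "card (insert w T) = r"
        using assms by simp
    qed (use assms in auto)
  qed auto
  then have "card {T. T \<subseteq> A \<and> card T = r \<and> w \<in> T} = card {T. T \<subseteq> A - {w} \<and> card T = r - 1}"
    by (simp add: bij_betw_same_card)
  also have "\<dots> = (card A - 1) choose (r - 1)"
    using assms by (simp add: n_subsets)
  finally show ?thesis .
qed

text \<open>Union bound over the vertices \<open>w\<close> of \<open>W - S\<close>: an edge
  \<open>e\<close> through \<open>S\<close> is determined by \<open>e - S\<close>, which contains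
  some such \<open>w\<close> and otherwise consists of \<open>k - d - 1\<close> vertices outside
  \<open>S\<close> and \<open>w\<close>.\<close>

lemma deg_le_of_edges_meet:
  assumes kg: "kgraph k H" and S: "S \<subseteq> verts H" "card S = d" "d < k"
    and W: "W \<subseteq> verts H" "card W \<le> c"
    and meet: "\<And>e. e \<in> edges H \<Longrightarrow> S \<subseteq> e \<Longrightarrow> e \<inter> (W - S) \<noteq> {}"
  shows "deg H S \<le> c * ((card (verts H) - d - 1) choose (k - d - 1))"
proof -
  let ?V = "verts H"
  let ?F = "\<lambda>w. {T. T \<subseteq> ?V - S \<and> card T = k - d \<and> w \<in> T}"
  let ?b = "(card ?V - d - 1) choose (k - d - 1)"
  have fin: "finite ?V" and edge: "\<And>e. e \<in> edges H \<Longrightarrow> e \<subseteq> ?V \<and> card e = k"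
    using kg by (auto simp: kgraph_def)
  have finS: "finite S" and finW: "finite W"
    using fin S(1) W(1) finite_subset by auto
  have "inj_on (\<lambda>e. e - S) {e \<in> edges H. S \<subseteq> e}"
    by (auto simp: inj_on_def)
  then have "deg H S = card ((\<lambda>e. e - S) ` {e \<in> edges H. S \<subseteq> e})"
    unfolding deg_def by (simp add: card_image)
  also have "\<dots> \<le> card (\<Union>w\<in>W - S. ?F w)"
  proof (rule card_mono)
    show "finite (\<Union>w\<in>W - S. ?F w)"
      using fin finW by auto
    show "(\<lambda>e. e - S) ` {e \<in> edges H. S \<subseteq> e} \<subseteq> (\<Union>w\<in>W - S. ?F w)"
    proof (rule image_subsetI, elim CollectE conjE)
      fix e assume e: "e \<in> edges H" "S \<subseteq> e"
      then obtain w where "w \<in> e" "w \<in> W - S"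
        using meet by blast
      moreover have "card (e - S) = k - d"
        using e edge[OF e(1)] S(2) finS by (simp add: card_Diff_subset)
      ultimately show "e - S \<in> (\<Union>w\<in>W - S. ?F w)"
        using edge[OF e(1)] by auto
    qed
  qed
  also have "\<dots> \<le> (\<Sum>w\<in>W - S. card (?F w))"
    using finW by (intro card_UN_le) auto
  also have "\<dots> = (\<Sum>w\<in>W - S. ?b)"
  proof (rule sum.cong[OF refl])
    fix w assume "w \<in> W - S"
    then show "card (?F w) = ?b"
      using fin W(1) S finS by (subst card_subsets_containing) (auto simp: card_Diff_subset)
  qed
  also have "\<dots> \<le> c * ?b"
    using W(2) finW card_mono[of W "W - S"] by (auto intro!: mult_le_mono1)
  finally show ?thesis .
qed

lemma min_deg_le_deg:
  assumes "finite (verts H)" "S \<subseteq> verts H" "card S = d"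
  shows "min_deg d H \<le> deg H S"
  unfolding min_deg_def using assms by (intro Min_le) auto

section \<open>Minimum degree of the modular k-graph\<close>

lemma obtain_subset_of_parts:
  assumes "finite V\<^sub>1" "finite V\<^sub>2" "V\<^sub>1 \<inter> V\<^sub>2 = {}" "s \<le> card V\<^sub>1" "t \<le> card V\<^sub>2"
  obtains S where "S \<subseteq> V\<^sub>1 \<union> V\<^sub>2" "card S = s + t" "card (S \<inter> V\<^sub>1) = s" "card (S \<inter> V\<^sub>2) = t"
proof -
  obtain A B where A: "A \<subseteq> V\<^sub>1" "card A = s" and B: "B \<subseteq> V\<^sub>2" "card B = t"
    using assms(4,5) by (meson obtain_subset_with_card_n)
  have "(A \<union> B) \<inter> V\<^sub>1 = A" "(A \<union> B) \<inter> V\<^sub>2 = B" "A \<inter> B = {}"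
    using A B assms(3) by auto
  moreover have "finite A" "finite B"
    using A B assms finite_subset by auto
  ultimately show thesis
    using that[of "A \<union> B"] A B by (auto simp: card_Un_disjoint)
qed

text \<open>The hypotheses on empty parts exclude complete k-graphs. Since there are at least
  \<open>2 * d\<close> vertices, at most one part has fewer than \<open>d\<close>, and the other can
  supply the rest of \<open>S\<close>.\<close>

lemma min_deg_modular_kgraph_le:
  assumes fin: "finite V\<^sub>1" "finite V\<^sub>2" and disj: "V\<^sub>1 \<inter> V\<^sub>2 = {}"
    and d: "0 < d" "d < k" "k - l \<le> d" "k < 2 * d" and j: "j \<le> l + 1"
    and large: "2 * d \<le> card (V\<^sub>1 \<union> V\<^sub>2)"
    and V\<^sub>1: "V\<^sub>1 = {} \<Longrightarrow> j \<noteq> 0" and V\<^sub>2: "V\<^sub>2 = {} \<Longrightarrow> \<not> [k = j] (mod (l + 2))"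
  shows "min_deg d (modular_kgraph k l j V\<^sub>1 V\<^sub>2)
           \<le> d * ((card (V\<^sub>1 \<union> V\<^sub>2) - d - 1) choose (k - d - 1))"
    (is "min_deg d ?H \<le> ?bound")
proof -
  have verts: "verts ?H = V\<^sub>1 \<union> V\<^sub>2"
    by (simp add: modular_kgraph_def)
  have edge: "e \<subseteq> V\<^sub>1 \<union> V\<^sub>2" "card e = k" "[card (e \<inter> V\<^sub>1) = j] (mod (l + 2))"
    if "e \<in> edges ?H" for e
    using that by (auto simp: modular_kgraph_def)
  have card_edge: "card (e \<inter> V\<^sub>1) + card (e \<inter> V\<^sub>2) = k" if "e \<in> edges ?H" for e
  proof -
    have "e = (e \<inter> V\<^sub>1) \<union> (e \<inter> V\<^sub>2)"
      using edge(1)[OF that] by auto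
    then have "card e = card (e \<inter> V\<^sub>1) + card (e \<inter> V\<^sub>2)"
      using fin disj by (metis card_Un_disjoint finite_Int inf_assoc inf_bot_right inf_commute)
    then show ?thesis
      using edge(2)[OF that] by simp
  qed
  have sum_card: "card V\<^sub>1 + card V\<^sub>2 \<ge> 2 * d"
    using large fin disj by (simp add: card_Un_disjoint)
  \<comment> \<open>Each case supplies its own \<open>S\<close> and \<open>W\<close>. If both parts
    are large, \<open>W\<close> is empty and the last premise says that no edge contains
    \<open>S\<close>; otherwise \<open>W\<close> is the small part.\<close>
  have few: "min_deg d ?H \<le> ?bound"
    if "S \<subseteq> V\<^sub>1 \<union> V\<^sub>2" "card S = d" "W \<subseteq> V\<^sub>1 \<union> V\<^sub>2" "card W \<le> d"
      "\<And>e. e \<in> edges ?H \<Longrightarrow> S \<subseteq> e \<Longrightarrow> e \<inter> (W - S) \<noteq> {}" for S W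
  proof -
    have "min_deg d ?H \<le> deg ?H S"
      using that fin verts by (intro min_deg_le_deg) auto
    also have "\<dots> \<le> ?bound"
      unfolding verts[symmetric]
      by (rule deg_le_of_edges_meet[OF kgraph_modular_kgraph[OF fin]]) (use that d verts in auto)
    finally show ?thesis .
  qed
  consider (both) "d \<le> card V\<^sub>1" "d \<le> card V\<^sub>2" | (small\<^sub>1) "card V\<^sub>1 < d" | (small\<^sub>2) "card V\<^sub>2 < d"
    by linarith
  then show ?thesis
  proof cases
    case both
    \<comment> \<open>An edge through \<open>S\<close> meets \<open>V\<^sub>1\<close> in between
      \<open>s\<close> and \<open>s + (k - d)\<close> vertices. If \<open>j < d\<close>, then
      \<open>k - d \<le> l\<close> places this range strictly between \<open>j\<close> and
      \<open>j + l + 2\<close>. If \<open>d \<le> j\<close>, the range starts at 0 and ends below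
      \<open>j\<close>, because \<open>k - d < d\<close>; as \<open>j \<le> l + 1\<close>, no
      wrap-around occurs.\<close>
    define s where "s = (if j < d then j + 1 else 0)"
    have "s \<le> d"
      by (simp add: s_def)
    then have "s \<le> card V\<^sub>1" "d - s \<le> card V\<^sub>2"
      using both by auto
    then obtain S where S: "S \<subseteq> V\<^sub>1 \<union> V\<^sub>2" "card S = s + (d - s)" "card (S \<inter> V\<^sub>1) = s"
        "card (S \<inter> V\<^sub>2) = d - s"
      using obtain_subset_of_parts[OF fin disj] by blast
    have False if e: "e \<in> edges ?H" and Se: "S \<subseteq> e" for e
    proof -
      have "s \<le> card (e \<inter> V\<^sub>1)" "d - s \<le> card (e \<inter> V\<^sub>2)"
        using S(3,4) Se fin by (metis card_mono finite_Int inf_mono order_refl)+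
      then have *: "s \<le> card (e \<inter> V\<^sub>1)" "card (e \<inter> V\<^sub>1) \<le> s + (k - d)"
        using card_edge[OF e] \<open>s \<le> d\<close> by auto
      show False
      proof (cases "j < d")
        case True
        then have "j < card (e \<inter> V\<^sub>1)" "card (e \<inter> V\<^sub>1) < j + (l + 2)"
          using * d by (auto simp: s_def)
        moreover have "l + 2 dvd card (e \<inter> V\<^sub>1) - j"
          using edge(3)[OF e] calculation(1) by (simp add: cong_altdef_nat)
        ultimately show False
          using dvd_imp_le[of "l + 2" "card (e \<inter> V\<^sub>1) - j"] by linarith
      next
        case False
        then have "card (e \<inter> V\<^sub>1) < j"
          using * d by (auto simp: s_def)
        then show False
          using edge(3)[OF e] j by (simp add: cong_def)
      qed
    qed
    then show ?thesis
      using few[of S "{}"] S \<open>s \<le> d\<close> by auto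
  next
    case small\<^sub>1
    \<comment> \<open>Chosen so that \<open>s\<close> is not congruent to \<open>j\<close>: an edge
      through \<open>S\<close> without further vertices of \<open>V\<^sub>1\<close> would meet
      \<open>V\<^sub>1\<close> in exactly \<open>s\<close> vertices.\<close>
    define s :: nat where "s = (if j = 0 then 1 else 0)"
    have s: "s \<le> card V\<^sub>1" "s \<le> d" "d - s \<le> card V\<^sub>2"
      using V\<^sub>1 fin small\<^sub>1 sum_card d by (auto simp: s_def Suc_le_eq card_gt_0_iff)
    then obtain S where S: "S \<subseteq> V\<^sub>1 \<union> V\<^sub>2" "card S = s + (d - s)" "card (S \<inter> V\<^sub>1) = s"
      using obtain_subset_of_parts[OF fin disj] by blast
    show ?thesis
    proof (rule few)
      fix e assume e: "e \<in> edges ?H" "S \<subseteq> e"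
      show "e \<inter> (V\<^sub>1 - S) \<noteq> {}"
      proof
        assume "e \<inter> (V\<^sub>1 - S) = {}"
        then have "e \<inter> V\<^sub>1 = S \<inter> V\<^sub>1"
          using e by auto
        then have "[s = j] (mod (l + 2))"
          using edge(3)[OF e(1)] S by simp
        then show False
          using j by (auto simp: s_def cong_def split: if_splits)
      qed
    qed (use S s small\<^sub>1 in auto)
  next
    case small\<^sub>2
    \<comment> \<open>An edge through \<open>S\<close> without further vertices of
      \<open>V\<^sub>2\<close> meets \<open>V\<^sub>1\<close> in \<open>k - t\<close> vertices.
      Consecutive integers differ modulo \<open>l + 2\<close>, so this choice makes
      \<open>k - t\<close> incongruent to \<open>j\<close>.\<close>
    define t :: nat where "t = (if [k = j] (mod (l + 2)) then 1 else 0)"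
    have t: "t \<le> card V\<^sub>2" "t \<le> d" "d - t \<le> card V\<^sub>1"
      using V\<^sub>2 fin small\<^sub>2 sum_card d by (auto simp: t_def Suc_le_eq card_gt_0_iff)
    then obtain S where S: "S \<subseteq> V\<^sub>1 \<union> V\<^sub>2" "card S = (d - t) + t" "card (S \<inter> V\<^sub>2) = t"
      using obtain_subset_of_parts[OF fin disj] by blast
    show ?thesis
    proof (rule few)
      fix e assume e: "e \<in> edges ?H" "S \<subseteq> e"
      show "e \<inter> (V\<^sub>2 - S) \<noteq> {}"
      proof
        assume "e \<inter> (V\<^sub>2 - S) = {}"
        then have "e \<inter> V\<^sub>2 = S \<inter> V\<^sub>2"
          using e by auto
        then have *: "card (e \<inter> V\<^sub>1) + t = k"
          using card_edge[OF e(1)] S by simp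
        show False
        proof (cases "[k = j] (mod (l + 2))")
          case True
          then have "[card (e \<inter> V\<^sub>1) + 1 = card (e \<inter> V\<^sub>1) + 0] (mod (l + 2))"
            using * edge(3)[OF e(1)] by (simp add: t_def cong_def)
          then show False
            unfolding cong_add_lcancel_nat by (simp add: cong_def)
        next
          case False
          then show False
            using * edge(3)[OF e(1)] by (simp add: t_def)
        qed
      qed
    qed (use S t small\<^sub>2 in auto)
  qed
qed

section \<open>Admissible values of \<open>x\<close> exclude complete k-graphs\<close>

lemma min_deg_Hgraph_le:
  assumes d: "0 < d" "d < k" "k - l \<le> d" "k < 2 * d" and j: "j \<le> l + 1"
    and n: "2 * d \<le> n" "l < k" "[n = l] (mod k)" and x: "x \<in> admissible k l j n"
  shows "min_deg d (Hgraph k l j n x) \<le> d * ((n - d - 1) choose (k - d - 1))"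
proof -
  obtain m where m: "x * real n = real m" "[m = (n div k) * j + l + 1] (mod (l + 2))"
    and x01: "0 \<le> x" "x \<le> 1"
    using x by (auto simp: admissible_def)
  have "real m \<le> real n"
    using m(1) x01 mult_left_le_one_le[of "real n" x] by simp
  then have "m \<le> n"
    by simp
  then have Un: "{..<m} \<union> {m..<n} = {..<n}"
    by auto
  have "n mod k = l"
    using n by (simp add: cong_def)
  then have nk: "n = (n div k) * k + l"
    by (metis div_mult_mod_eq)
  have "min_deg d (modular_kgraph k l j {..<m} {m..<n})
          \<le> d * ((card ({..<m} \<union> {m..<n}) - d - 1) choose (k - d - 1))"
  proof (rule min_deg_modular_kgraph_le)
    assume "{..<m} = {}"
    then have "m = 0"
      by (auto simp: lessThan_empty_iff bot_nat_def)
    then show "j \<noteq> 0"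
      \<comment> \<open>For \<open>j = 0\<close> the congruence for \<open>m = 0\<close> would say
        that \<open>l + 2\<close> divides \<open>l + 1\<close>.\<close>
      using m(2) by (intro notI) (simp add: cong_def)
  next
    assume "{m..<n} = {}"
    then have "m = n"
      using \<open>m \<le> n\<close> by simp
    show "\<not> [k = j] (mod (l + 2))"
    proof
      assume "[k = j] (mod (l + 2))"
      \<comment> \<open>The left side is \<open>n\<close>, hence \<open>m\<close>; admissibility
        prescribes a residue larger by exactly 1.\<close>
      then have "[(n div k) * k + l = (n div k) * j + l] (mod (l + 2))"
        by (intro cong_add cong_mult) auto
      then have "[(n div k) * j + l + 1 = (n div k) * j + l + 0] (mod (l + 2))"
        using m(2) \<open>m = n\<close> nk by (metis add_0_right cong_sym cong_trans)
      then show False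
        unfolding cong_add_lcancel_nat by (simp add: cong_def)
    qed
  qed (use d j n(1) in \<open>auto simp: Un\<close>)
  then show ?thesis
    by (simp add: Hgraph_def m(1) Un)
qed

section \<open>From single k-graphs to the maximal ratio\<close>

lemma finite_admissible: "n > 0 \<Longrightarrow> finite (admissible k l j n)"
proof (rule finite_subset)
  assume n: "n > 0"
  show "admissible k l j n \<subseteq> (\<lambda>m. real m / real n) ` {..n}"
  proof
    fix x assume x: "x \<in> admissible k l j n"
    then obtain m where m: "x * real n = real m" and "0 \<le> x" "x \<le> 1"
      by (auto simp: admissible_def)
    then have "real m \<le> real n"
      using mult_left_le_one_le[of "real n" x] by simp
    then show "x \<in> (\<lambda>m. real m / real n) ` {..n}"
      using m n by (intro image_eqI[of _ _ m]) (auto simp: field_simps)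
  qed
qed simp

lemma admissible_nonempty:
  assumes "l < n"
  shows "admissible k l j n \<noteq> {}"
proof -
  \<comment> \<open>The least representative of the prescribed residue is at most
    \<open>l + 1\<close>, hence at most \<open>n\<close>.\<close>
  define m where "m = ((n div k) * j + l + 1) mod (l + 2)"
  have "m < l + 2"
    unfolding m_def by (rule mod_less_divisor) simp
  then have "m \<le> n"
    using assms by simp
  then have "real m / real n \<in> admissible k l j n"
    using assms unfolding admissible_def
    by (auto intro!: exI[of _ m] simp: m_def cong_def divide_le_eq)
  then show ?thesis
    by blast
qed

lemma max_min_deg_ratio_le:
  assumes d: "0 < d" "d < k" "k - l \<le> d" "k < 2 * d"
    and n: "2 * d \<le> n" "l < k" "k < n" "[n = l] (mod k)"
  shows "max_min_deg_ratio k d l n \<le> real (d * (k - d)) / real (n - d)"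
proof -
  let ?b = "(n - d - 1) choose (k - d - 1)"
  have "l < n" "0 < n"
    using n by auto
  have "(MAX x\<in>admissible k l j n. min_deg d (Hgraph k l j n x)) \<le> d * ?b" if "j \<le> l + 1" for j
    using finite_admissible[OF \<open>0 < n\<close>] admissible_nonempty[OF \<open>l < n\<close>]
      min_deg_Hgraph_le[OF d that n(1,2,4)]
    by (subst Max_le_iff) auto
  then have "(MAX j\<in>{0..l + 1}. MAX x\<in>admissible k l j n. min_deg d (Hgraph k l j n x)) \<le> d * ?b"
    by (subst Max_le_iff) auto
  then have "max_min_deg_ratio k d l n \<le> real (d * ?b) / real ((n - d) choose (k - d))"
    unfolding max_min_deg_ratio_def
    by (intro divide_right_mono) (simp_all only: of_nat_le_iff of_nat_0_le_iff)
  also have "\<dots> = real (d * (k - d)) / real (n - d)"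
  proof -
    \<comment> \<open>The absorption identity turns the quotient of the two binomial coefficients
      into \<open>(k - d) / (n - d)\<close>.\<close>
    have "(k - d) * ((n - d) choose (k - d)) = (n - d) * ?b"
      using d n by (intro times_binomial_minus1_eq) auto
    then have "real (k - d) * real ((n - d) choose (k - d)) = real (n - d) * real ?b"
      by (metis of_nat_mult)
    moreover have "(n - d) choose (k - d) > 0" "n - d > 0"
      using d n by auto
    ultimately show ?thesis
      by (simp add: frac_eq_eq mult.assoc mult.commute)
  qed
  finally show ?thesis .
qed

section \<open>The limit along the residue class\<close>

lemma eventually_at_top_cong:
  "eventually P (at_top_cong k l) \<longleftrightarrow> (\<forall>\<^sub>F n in at_top. [n = l] (mod k) \<longrightarrow> P n)"
  by (simp add: at_top_cong_def eventually_inf_principal)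

text \<open>Limits are unique only along a proper filter; this is what lets convergence determine
  the value of \<open>Lim\<close> in \<open>g\<close>. The class contains the arbitrarily large
  numbers \<open>l + N * k\<close>.\<close>

lemma at_top_cong_neq_bot:
  assumes "k > 0"
  shows "at_top_cong k l \<noteq> bot"
proof
  assume "at_top_cong k l = bot"
  then have "eventually (\<lambda>_. False) (at_top_cong k l)"
    by simp
  then obtain N where N: "\<And>n. n \<ge> N \<Longrightarrow> \<not> [n = l] (mod k)"
    by (auto simp: eventually_at_top_cong eventually_at_top_linorder)
  have "N \<le> l + N * k"
    using assms by (simp add: trans_le_add2)
  then show False
    using N[of "l + N * k"] by (simp add: cong_def)
qed

theorem proposition1p12:
  fixes k d l :: nat
  assumes "1 \<le> d" and "d \<le> k - 1"
    and "0 \<le> l" and "l \<le> k - 1"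
    and "d \<ge> max (k - l) (k div 2 + 1)"
  shows "(max_min_deg_ratio k d l \<longlongrightarrow> g k d l) (at_top_cong k l) \<and> g k d l = 0"
proof -
  \<comment> \<open>The bounds on \<open>d\<close> force \<open>k \<ge> 2\<close>, so the
    subtraction in \<open>k - 1\<close> is not truncated.\<close>
  have d: "0 < d" "d < k" "k - l \<le> d" "k < 2 * d" and "l < k"
    using assms by auto
  have "(max_min_deg_ratio k d l \<longlongrightarrow> 0) (at_top_cong k l)"
  proof (rule tendsto_sandwich)
    show "\<forall>\<^sub>F n in at_top_cong k l. 0 \<le> max_min_deg_ratio k d l n"
      unfolding max_min_deg_ratio_def by simp
    show "\<forall>\<^sub>F n in at_top_cong k l. max_min_deg_ratio k d l n \<le> real (d * (k - d)) / real (n - d)"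
      unfolding eventually_at_top_cong
      using eventually_ge_at_top[of "2 * d"] eventually_gt_at_top[of k]
      by eventually_elim (use max_min_deg_ratio_le[OF d] \<open>l < k\<close> in blast)
    have "filterlim (\<lambda>n. real (n - d)) at_top at_top"
      by (rule filterlim_compose[OF filterlim_real_sequentially filterlim_minus_const_nat_at_top])
    then have "(\<lambda>n. real (d * (k - d)) / real (n - d)) \<longlonglongrightarrow> 0"
      by (rule real_tendsto_divide_at_top[OF tendsto_const])
    then show "((\<lambda>n. real (d * (k - d)) / real (n - d)) \<longlongrightarrow> 0) (at_top_cong k l)"
      unfolding at_top_cong_def by (rule tendsto_mono[OF inf_le1])
  qed simp
  moreover from this have "g k d l = 0"
    unfolding g_def using at_top_cong_neq_bot \<open>l < k\<close> by (intro tendsto_Lim) auto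
  ultimately show ?thesis
    by simp
qed

end
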